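(* For any integer $k\geq 1$ and any $e\in\{0,1,\ldots,k-1\}$, the mapping $f$ restricted to $D_{2k}^e$ is a bijection between $D_{2k}^e$ and $D_{2k}^{e+1}$. Moreover, for every $x\in D_{2k}^e$, the Dyck paths $x$ and $f(x)$ (viewed as sequences of $2k$ steps) differ in exactly two positions.
   Context: A lattice path with $n$ steps is a sequence $x=(x_1,\ldots,x_n)$ of steps, each either an up-step $(1,1)$ or a down-step $(1,-1)$, drawn in $\mathbb{Z}^2$ starting at the origin; step $x_i$ goes from $(i-1,h_{i-1})$ to $(i,h_i)$, where $h_i$ is the height after $i$ steps. A step lies below the line $y=c$ if both of its endpoints have $y$-coordinate at most $c$. A step touches the line $y=c$ if it starts or ends on that line. For $c\in\mathbb{Z}$, $u_c(x)$ and $d_c(x)$ denote the number of up-steps, respectively down-steps, of $x$ that start on the line $y=c$. Let $L_{2k,k}$ (resp. $L_{2k,k+1}$) be the set of lattice paths with $2k$ steps of which exactly $k$ (resp. $k+1$) are up-steps. For $e\in\{0,\ldots,k\}$, $D_{2k}^e$ is the set of paths in $L_{2k,k}$ having exactly $e$ down-steps below the line $y=0$ (Dyck paths with $2k$ steps and $e$ flaws). For $x\in L_{2k,k}\setminus D_{2k}^k$, let $g(x)$ be the path obtained from $x$ by replacing by an up-step the $(d_0(x)+1)$-th (counted from the left) down-step of $x$ touching the line $y=0$. For $x'\in L_{2k,k+1}$, let $h(x')$ be the path obtained from $x'$ by replacing by a down-step the $u_1(x')$-th (counted from the left) up-step of $x'$ touching the line $y=1$. Define $f(x):=h(g(x))$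 for $x\in L_{2k,k}\setminus D_{2k}^k$. *)

theory Defs
  imports Main
begin

datatype step = Up | Down

type_synonym path = "step list"

fun step_val :: "step \<Rightarrow> int" where
  "step_val Up = 1"
| "step_val Down = - 1"

definition height :: "path \<Rightarrow> nat \<Rightarrow> int" where
  "height x i = sum_list (map step_val (take i x))"

(* Positions are 0-based: for i < length x, the step x ! i leads from
   (i, height x i) to (i + 1, height x (i + 1)). *)

definition below :: "path \<Rightarrow> int \<Rightarrow> nat \<Rightarrow> bool" where
  "below x c i \<longleftrightarrow> height x i \<le> c \<and> height x (Suc i) \<le> c"

definition touches :: "path \<Rightarrow> int \<Rightarrow> nat \<Rightarrow> bool" where
  "touches x c i \<longleftrightarrow> height x i = c \<or> height x (Suc i) = c"

definition up_from :: "int \<Rightarrow> path \<Rightarrow> nat" where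
  "up_from c x = card {i. i < length x \<and> x ! i = Up \<and> height x i = c}"

definition down_from :: "int \<Rightarrow> path \<Rightarrow> nat" where
  "down_from c x = card {i. i < length x \<and> x ! i = Down \<and> height x i = c}"

definition paths :: "nat \<Rightarrow> nat \<Rightarrow> path set" where
  "paths n m = {x. length x = n \<and> card {i. i < n \<and> x ! i = Up} = m}"

(* Dyck paths with 2 * k steps and e flaws. *)
definition dyck_flaws :: "nat \<Rightarrow> nat \<Rightarrow> path set" where
  "dyck_flaws k e =
     {x \<in> paths (2 * k) k. card {i. i < 2 * k \<and> x ! i = Down \<and> below x 0 i} = e}"

(* Positions, from left to right, of the steps of kind s that touch the line y = c. *)
definition touching :: "step \<Rightarrow> int \<Rightarrow> path \<Rightarrow> nat list" where
  "touching s c x = filter (\<lambda>i. x ! i = s \<and> touches x c i) [0..<length x]"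

(* List indexing is 0-based, so the (d + 1)-th entry is touching ... ! d.
   The indices below are in range for x in paths (2 * k) k - dyck_flaws k k
   (map_g) and for x in paths (2 * k) (k + 1) (map_h, where also up_from 1 x > 0);
   the maps are only meaningful there. *)

definition map_g :: "path \<Rightarrow> path" where
  "map_g x = x[touching Down 0 x ! down_from 0 x := Up]"

definition map_h :: "path \<Rightarrow> path" where
  "map_h x = x[touching Up 1 x ! (up_from 1 x - 1) := Down]"

definition map_f :: "path \<Rightarrow> path" where
  "map_f x = map_h (map_g x)"

end

theory Submission
  imports Defs
begin

text \<open>
  Turn a down-step of a balanced path \<open>x\<close> that touches \<open>y = 0\<close> into an up-step; in the resulting
  path \<open>x'\<close> it is an up-step touching \<open>y = 1\<close>. If it has index \<open>j\<close> (from 0) among the down-steps of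
  \<open>x\<close> touching \<open>y = 0\<close> and index \<open>i\<close> among the up-steps of \<open>x'\<close> touching \<open>y = 1\<close>, then counting level
  crossings before and after it gives \<open>i - u\<^sub>1(x') = j - d\<^sub>0(x)\<close>, and the number of down-steps of \<open>x'\<close>
  below \<open>y = 1\<close> exceeds the number of flaws of \<open>x\<close> by the same amount. Hence \<open>g\<close> (\<open>j = d\<^sub>0(x)\<close>) is
  undone by flipping the up-step of index \<open>u\<^sub>1(x')\<close> and keeps the flaw count, whereas \<open>h\<close>
  (\<open>i = u\<^sub>1(x') - 1\<close>) is undone by flipping the down-step of index \<open>d\<^sub>0(x) - 1\<close> and raises it by one.
  As the two indices among the up-steps of \<open>g(x)\<close> differ, \<open>f\<close> changes two distinct positions.
\<close>

section \<open>Counting steps by kind and starting height\<close>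

fun count_steps :: "(step \<Rightarrow> int \<Rightarrow> bool) \<Rightarrow> int \<Rightarrow> path \<Rightarrow> nat" where
  "count_steps P h [] = 0"
| "count_steps P h (s # x) = of_bool (P s h) + count_steps P (h + step_val s) x"

abbreviation rise :: "path \<Rightarrow> int" where
  "rise x \<equiv> sum_list (map step_val x)"

text \<open>The reason for counting from an arbitrary height \<open>h\<close>: a path can be cut at
  a step, and the second piece starts at the height that the first one reaches.\<close>

lemma count_steps_append:
  "count_steps P h (x @ y) = count_steps P h x + count_steps P (h + rise x) y"
  by (induction x arbitrary: h) (auto simp: add.assoc)

text \<open>Needed for the part of a path to the right of a flipped step, which moves vertically as
  a whole.\<close>

lemma count_steps_shift:
  "count_steps P (h + c) x = count_steps (\<lambda>s t. P s (t + c)) h x"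
proof (induction x arbitrary: h)
  case (Cons s x)
  from Cons[of "h + step_val s"] show ?case by (simp add: algebra_simps)
qed simp

lemma count_steps_disj:
  assumes "\<And>s t. P s t \<longleftrightarrow> Q s t \<or> R s t" "\<And>s t. \<not> (Q s t \<and> R s t)"
  shows "count_steps P h x = count_steps Q h x + count_steps R h x"
  using assms by (induction x arbitrary: h) auto

lemma height_append: "i \<le> length x \<Longrightarrow> height (x @ y) i = height x i"
  by (simp add: height_def)

lemma height_take: "i \<le> p \<Longrightarrow> height (take p x) i = height x i"
  by (simp add: height_def min_def)

lemma height_length: "height x (length x) = rise x"
  by (simp add: height_def)

lemma height_Suc:
  "i < length x \<Longrightarrow> height x (Suc i) = height x i + step_val (x ! i)"
  by (simp add: height_def take_Suc_conv_app_nth)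

lemma height_update: "i \<le> p \<Longrightarrow> height (x[p := s]) i = height x i"
  by (simp add: height_def)

lemma card_eq_count_steps:
  "card {i. i < length x \<and> P (x ! i) (height x i)} = count_steps P 0 x"
\<comment> \<open>Heights are sums over prefixes, so appending a step at the end leaves all earlier
  ones unchanged.\<close>
proof (induction x rule: rev_induct)
  case (snoc s x)
  let ?A = "{i. i < length x \<and> P (x ! i) (height x i)}"
  have "{i. i < length (x @ [s]) \<and> P ((x @ [s]) ! i) (height (x @ [s]) i)} =
      ?A \<union> (if P s (rise x) then {length x} else {})"
    by (auto simp: nth_append height_append height_length less_Suc_eq split: if_splits)
  then show ?case
    using snoc by (simp add: count_steps_append)
qed simp

section \<open>Indices in the lists of touching steps\<close>

lemma nth_filter_upt:
  assumes "j < length (filter Q [0..<n])" and "p = filter Q [0..<n] ! j"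
  shows "p < n \<and> Q p \<and> length (filter Q [0..<p]) = j"
  using assms
  by (induction n) (auto simp: nth_append split: if_splits)

text \<open>Converse of \<open>nth_filter_upt\<close>. Together they identify the index of an entry
  with the number of hits before it, which turns indexing into \<open>touching\<close> into a count
  over a prefix.\<close>

lemma filter_upt_nth:
  assumes "p < n" "Q p"
  shows "length (filter Q [0..<p]) < length (filter Q [0..<n])"
    and "filter Q [0..<n] ! length (filter Q [0..<p]) = p"
proof -
  have "[0..<n] = [0..<p] @ p # [Suc p..<n]"
    using assms(1) upt_add_eq_append[of 0 p "n - p"] by (simp add: upt_conv_Cons)
  then show "length (filter Q [0..<p]) < length (filter Q [0..<n])"
    and "filter Q [0..<n] ! length (filter Q [0..<p]) = p"
    using assms(2) by simp_all
qed

lemma length_filter_upt: "length (filter Q [0..<n]) = card {i. i < n \<and> Q i}"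
  by (simp add: length_filter_conv_card cong: conj_cong)

text \<open>The end height is expressed through the starting height \<open>t\<close>, so that
  touching becomes a predicate fit for \<open>count_steps\<close>.\<close>

definition touch :: "step \<Rightarrow> int \<Rightarrow> step \<Rightarrow> int \<Rightarrow> bool" where
  "touch s c s' t \<longleftrightarrow> s' = s \<and> (t = c \<or> t + step_val s = c)"

lemma touches_iff_touch:
  "i < length x \<Longrightarrow> x ! i = s \<and> touches x c i \<longleftrightarrow> touch s c (x ! i) (height x i)"
  by (auto simp: touches_def touch_def height_Suc)

lemma length_filter_touches:
  assumes "p \<le> length x"
  shows "length (filter (\<lambda>i. x ! i = s \<and> touches x c i) [0..<p]) =
    count_steps (touch s c) 0 (take p x)"
proof -
  have "{i. i < p \<and> x ! i = s \<and> touches x c i} =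
      {i. i < length (take p x) \<and> touch s c (take p x ! i) (height (take p x) i)}"
    using assms by (auto simp: height_take simp flip: touches_iff_touch)
  then show ?thesis
    by (simp only: length_filter_upt card_eq_count_steps)
qed

lemma length_touching: "length (touching s c x) = count_steps (touch s c) 0 x"
  using length_filter_touches[of "length x" x] by (simp add: touching_def)

lemma touching_nth:
  assumes "j < length (touching s c x)" and "p = touching s c x ! j"
  shows "p < length x" "x ! p = s" "touches x c p"
    "count_steps (touch s c) 0 (take p x) = j"
  using nth_filter_upt[OF assms[unfolded touching_def]] by (auto simp: length_filter_touches)

lemma nth_touching:
  assumes "p < length x" "x ! p = s" "touches x c p"
  shows "count_steps (touch s c) 0 (take p x) < length (touching s c x)"
    and "touching s c x ! count_steps (touch s c) 0 (take p x) = p"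
  using filter_upt_nth[of p "length x" "\<lambda>i. x ! i = s \<and> touches x c i"] assms
  by (simp_all add: length_filter_touches touching_def)

section \<open>Level crossings and the effect of flipping one step\<close>

abbreviation from_level :: "step \<Rightarrow> int \<Rightarrow> step \<Rightarrow> int \<Rightarrow> bool" where
  "from_level s c \<equiv> \<lambda>s' t. s' = s \<and> t = c"

abbreviation down_below :: "int \<Rightarrow> step \<Rightarrow> int \<Rightarrow> bool" where
  "down_below c \<equiv> \<lambda>s' t. s' = Down \<and> t \<le> c"

definition downs_below :: "int \<Rightarrow> path \<Rightarrow> nat" where
  "downs_below c x = card {i. i < length x \<and> x ! i = Down \<and> below x c i}"

text \<open>A down-step ends lower than it starts, so only its starting height matters.\<close>

lemma downs_below_eq: "downs_below c x = count_steps (down_below c) 0 x"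
proof -
  have "{i. i < length x \<and> x ! i = Down \<and> below x c i} =
      {i. i < length x \<and> down_below c (x ! i) (height x i)}"
    by (auto simp: below_def height_Suc)
  then show ?thesis
    using card_eq_count_steps[of x "down_below c"] by (simp add: downs_below_def)
qed

lemma down_from_eq: "down_from c x = count_steps (from_level Down c) 0 x"
  by (simp add: down_from_def flip: card_eq_count_steps)

lemma up_from_eq: "up_from c x = count_steps (from_level Up c) 0 x"
  by (simp add: up_from_def flip: card_eq_count_steps)

text \<open>The two kinds of steps cross the strip between \<open>c\<close> and \<open>c + 1\<close>
  in opposite directions, so their difference depends only on the sides of the strip on which the
  path starts and ends.\<close>

lemma count_crossings:
  "int (count_steps (from_level Up c) h x) - int (count_steps (from_level Down (c + 1)) h x) =
    of_bool (c < h + rise x) - of_bool (c < h)"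
proof (induction x arbitrary: h)
  case (Cons s x)
  from Cons[of "h + step_val s"] show ?case
    by (cases s) (auto simp: of_bool_def add.assoc)
qed simp

lemma count_touch:
  "count_steps (touch s c) h x =
    count_steps (from_level s c) h x + count_steps (from_level s (c - step_val s)) h x"
  by (rule count_steps_disj) (cases s; auto simp: touch_def)+

lemma count_down_below:
  "count_steps (down_below (c + 1)) h x =
    count_steps (down_below c) h x + count_steps (from_level Down (c + 1)) h x"
  by (rule count_steps_disj) auto

text \<open>All three differences equal the number of down-steps of \<open>x\<close> from level 1
  before \<open>p\<close> minus the number of those from level 0 at or after
  \<open>p\<close>.\<close>

lemma flip_step:
  assumes p: "p < length x" "x ! p = Down" "touches x 0 p" and "rise x = 0"
  defines "x' \<equiv> x[p := Up]"
  shows "int (count_steps (touch Up 1) 0 (take p x')) - int (up_from 1 x') =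
      int (count_steps (touch Down 0) 0 (take p x)) - int (down_from 0 x)"
    and "int (downs_below 1 x') - int (downs_below 0 x) =
      int (count_steps (touch Down 0) 0 (take p x)) - int (down_from 0 x)"
proof -
  define y z where "y = take p x" and "z = drop (Suc p) x"
  have x: "x = y @ Down # z"
    using p by (simp add: y_def z_def id_take_nth_drop[symmetric] flip: p(2))
  have x': "x' = y @ Up # z"
    using p by (simp add: x'_def y_def z_def upd_conv_take_nth_drop)
  have y': "take p x' = y"
    by (simp add: x'_def y_def)
  have a: "rise y = 0 \<or> rise y = 1"
    using p by (auto simp: touches_def height_Suc) (auto simp: height_def y_def)
  have rise: "rise y - 1 + rise z = 0"
    using \<open>rise x = 0\<close> by (simp add: x)
  \<comment> \<open>The suffix \<open>z\<close> starts at \<open>rise y - 1\<close> in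
    \<open>x\<close> and 2 higher in \<open>x'\<close>.\<close>
  note shift = count_steps_shift[of _ "rise y - 1" 2 z, simplified]
  \<comment> \<open>The strip from 0 to 1 is used before \<open>p\<close>. After \<open>p\<close> it
    is the strip from -1 to 0 of \<open>x\<close>, whose up-steps become up-steps from level 1 in
    \<open>x'\<close>.\<close>
  note cross = count_crossings[of 0 0 y] count_crossings[of "-1" "rise y - 1" z]
  note eqs = x x' y' up_from_eq down_from_eq downs_below_eq count_steps_append count_touch
  have lev: "(t + 2 = 1) = (t = - 1)" "(t + 2 \<le> 1) = (t \<le> - 1)" for t :: int
    by auto
  have up: "count_steps (from_level Up 1) (rise y + 1) z =
      count_steps (from_level Up (- 1)) (rise y - 1) z"
    and below: "count_steps (down_below 1) (rise y + 1) z =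
      count_steps (down_below (- 1)) (rise y - 1) z"
    using shift[of "from_level Up 1"] shift[of "down_below 1"] unfolding lev
    by (simp_all add: add.commute)
  have b1: "count_steps (down_below 1) 0 y =
      count_steps (down_below 0) 0 y + count_steps (from_level Down 1) 0 y"
    using count_down_below[of 0 0 y] by simp
  have b2: "count_steps (down_below 0) (rise y - 1) z =
      count_steps (down_below (- 1)) (rise y - 1) z + count_steps (from_level Down 0) (rise y - 1) z"
    using count_down_below[of "-1" "rise y - 1" z] by simp
  show "int (count_steps (touch Up 1) 0 (take p x')) - int (up_from 1 x') =
      int (count_steps (touch Down 0) 0 (take p x)) - int (down_from 0 x)"
    unfolding y' y_def[symmetric] unfolding eqs
    using a rise cross up by auto
  show "int (downs_below 1 x') - int (downs_below 0 x) =
      int (count_steps (touch Down 0) 0 (take p x)) - int (down_from 0 x)"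
    unfolding y_def[symmetric] unfolding eqs
    using a rise cross below b1 b2 by auto
qed

section \<open>Flips between paths ending at heights 0 and 2\<close>

lemma rise_eq: "rise x = 2 * int (card {i. i < length x \<and> x ! i = Up}) - int (length x)"
proof -
  have "card {i. i < length x \<and> x ! i = Up} = count_steps (\<lambda>s _. s = Up) 0 x"
    using card_eq_count_steps[of x "\<lambda>s _. s = Up"] by simp
  moreover have "rise x = 2 * int (count_steps (\<lambda>s _. s = Up) h x) - int (length x)" for h
  proof (induction x arbitrary: h)
    case (Cons s x)
    from Cons[of "h + step_val s"] show ?case by (cases s) auto
  qed simp
  ultimately show ?thesis by simp
qed

lemma paths_iff: "x \<in> paths n m \<longleftrightarrow> length x = n \<and> rise x = 2 * int m - int n"
  by (auto simp: paths_def rise_eq)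

lemma rise_update:
  assumes "p < length x"
  shows "rise (x[p := s]) = rise x + step_val s - step_val (x ! p)"
  using arg_cong[OF id_take_nth_drop[OF assms], of rise] assms
  by (simp add: upd_conv_take_nth_drop)

text \<open>Treats \<open>map_g\<close> (\<open>r = 0\<close>) and the inverse of
  \<open>map_h\<close> (\<open>r = 1\<close>) together: \<open>r\<close> is the distance of the
  index below \<open>down_from 0 x\<close>, and \<open>flip_step\<close> makes it the distance below
  \<open>up_from 1 x'\<close> as well.\<close>

lemma flip_down:
  assumes x: "x \<in> paths (2 * k) k"
    and r: "r \<le> down_from 0 x" "down_from 0 x - r < length (touching Down 0 x)"
    and p_def: "p = touching Down 0 x ! (down_from 0 x - r)"
    and x'_def: "x' = x[p := Up]"
  shows "p < 2 * k" "x ! p = Down" "x' \<in> paths (2 * k) (k + 1)" "r \<le> up_from 1 x'"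
    "up_from 1 x' - r < length (touching Up 1 x')" "touching Up 1 x' ! (up_from 1 x' - r) = p"
    "x'[p := Down] = x" "downs_below 1 x' + r = downs_below 0 x"
proof -
  note p = touching_nth[OF r(2) p_def]
  have len: "length x = 2 * k" and rise: "rise x = 0"
    using x by (simp_all add: paths_iff)
  show "p < 2 * k" "x ! p = Down" using p len by auto
  show "x' \<in> paths (2 * k) (k + 1)"
    using p len rise by (simp add: paths_iff x'_def rise_update)
  note flip = flip_step[OF p(1-3) rise, folded x'_def]
  show "x'[p := Down] = x"
    by (simp add: x'_def flip: p(2))
  have tp: "p < length x'" "x' ! p = Up" "touches x' 1 p"
    using p by (auto simp: x'_def touches_def height_Suc height_update)
  \<comment> \<open>The sum form also yields \<open>r \<le> up_from 1 x'\<close>, so the subtraction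
    of naturals that follows does not truncate.\<close>
  have i: "count_steps (touch Up 1) 0 (take p x') + r = up_from 1 x'"
    using flip(1) p(4) r(1) by linarith
  then have "count_steps (touch Up 1) 0 (take p x') = up_from 1 x' - r"
    by simp
  with i show "r \<le> up_from 1 x'" "up_from 1 x' - r < length (touching Up 1 x')"
    "touching Up 1 x' ! (up_from 1 x' - r) = p"
    using nth_touching[OF tp] by simp_all
  show "downs_below 1 x' + r = downs_below 0 x"
    using flip(2) p(4) r(1) by linarith
qed

text \<open>The opposite direction: the inverse of \<open>map_g\<close> for \<open>r = 0\<close> and
  \<open>map_h\<close> for \<open>r = 1\<close>. Since \<open>x\<close> ends at height 0,
  \<open>flip_step\<close> applies to it and is read backwards.\<close>

lemma flip_up:
  assumes x': "x' \<in> paths (2 * k) (k + 1)"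
    and r: "r \<le> up_from 1 x'" "up_from 1 x' - r < length (touching Up 1 x')"
    and p_def: "p = touching Up 1 x' ! (up_from 1 x' - r)"
    and x_def: "x = x'[p := Down]"
  shows "p < 2 * k" "x' ! p = Up" "x \<in> paths (2 * k) k"
    "touching Down 0 x ! (down_from 0 x - r) = p"
    "x[p := Up] = x'" "downs_below 1 x' + r = downs_below 0 x"
proof -
  note p = touching_nth[OF r(2) p_def]
  have len: "length x' = 2 * k" and "rise x' = 2"
    using x' by (simp_all add: paths_iff)
  show "p < 2 * k" "x' ! p = Up" using p len by auto
  have rise: "rise x = 0"
    using p \<open>rise x' = 2\<close> by (simp add: x_def rise_update)
  then show "x \<in> paths (2 * k) k"
    using len by (simp add: paths_iff x_def)
  show upd: "x[p := Up] = x'"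
    by (simp add: x_def flip: p(2))
  have tp: "p < length x" "x ! p = Down" "touches x 0 p"
    using p by (auto simp: x_def touches_def height_Suc height_update)
  note flip = flip_step[OF tp rise, unfolded upd]
  have j: "count_steps (touch Down 0) 0 (take p x) + r = down_from 0 x"
    using flip(1) p(4) r(1) by linarith
  then have "count_steps (touch Down 0) 0 (take p x) = down_from 0 x - r"
    by simp
  then show "touching Down 0 x ! (down_from 0 x - r) = p"
    using nth_touching[OF tp] by simp
  show "downs_below 1 x' + r = downs_below 0 x"
    using flip(2) j by linarith
qed

section \<open>Flaws and the ranges of the indices\<close>

lemma dyck_flaws_iff: "x \<in> dyck_flaws k e \<longleftrightarrow> x \<in> paths (2 * k) k \<and> downs_below 0 x = e"
  by (auto simp: dyck_flaws_def paths_def downs_below_def)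

text \<open>Such a path never rises above 0, so each of its down-steps starts at height at most
  0.\<close>

lemma count_nonpositive:
  assumes "count_steps (from_level Up 0) h x = 0" "h \<le> 0"
  shows "count_steps (down_below 0) h x + count_steps (\<lambda>s _. s = Up) h x = length x"
  using assms
proof (induction x arbitrary: h)
  case (Cons s x)
  then show ?case by (cases s) auto
qed simp

text \<open>Such a path never drops below 0, and a down-step counted here would have to start at
  0.\<close>

lemma count_nonnegative:
  assumes "count_steps (from_level Down 0) h x = 0" "h \<ge> 0"
  shows "count_steps (down_below 0) h x = 0"
  using assms
proof (induction x arbitrary: h)
  case (Cons s x)
  then show ?case by (cases s) (auto simp: of_bool_def split: if_splits)
qed simp

text \<open>Makes the index used by \<open>map_g\<close> valid. Otherwise no down-step starts at
  level 1, hence no up-step at level 0, the path stays at or below 0, and all \<open>k\<close>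
  down-steps are flaws.\<close>

lemma down_from_0_less:
  assumes "x \<in> dyck_flaws k e" "e < k"
  shows "down_from 0 x < length (touching Down 0 x)"
proof (rule ccontr)
  assume "\<not> ?thesis"
  then have "count_steps (from_level Down 1) 0 x = 0"
    by (simp add: length_touching down_from_eq count_touch)
  moreover have "length x = 2 * k" "rise x = 0" "downs_below 0 x = e"
    using assms(1) by (auto simp: dyck_flaws_iff paths_iff)
  ultimately have "count_steps (from_level Up 0) 0 x = 0"
    using count_crossings[of 0 0 x] by simp
  from count_nonpositive[OF this] have "e + count_steps (\<lambda>s _. s = Up) 0 x = 2 * k"
    using \<open>length x = 2 * k\<close> \<open>downs_below 0 x = e\<close> by (simp add: downs_below_eq)
  moreover have "count_steps (\<lambda>s _. s = Up) 0 x = k"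
    using assms(1) card_eq_count_steps[of x "\<lambda>s _. s = Up"]
    by (auto simp: dyck_flaws_def paths_def)
  ultimately show False using \<open>e < k\<close> by simp
qed

text \<open>A flaw takes the path below 0, which it can only reach by a down-step from level 0. This
  validates the index for the inverse of \<open>map_h\<close>.\<close>

lemma down_from_0_pos:
  assumes "x \<in> dyck_flaws k (Suc e)"
  shows "1 \<le> down_from 0 x" "down_from 0 x - 1 < length (touching Down 0 x)"
proof -
  show "1 \<le> down_from 0 x"
    using assms count_nonnegative[of 0 x]
    by (cases "down_from 0 x") (auto simp: dyck_flaws_iff downs_below_eq down_from_eq)
  then show "down_from 0 x - 1 < length (touching Down 0 x)"
    by (simp add: length_touching count_touch down_from_eq)
qed

text \<open>A path ending at height 2 crosses the strips from 0 to 1 and from 1 to 2, so it has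
  up-steps from both level 0 and level 1, and both kinds touch level 1.\<close>

lemma up_from_1_bounds:
  assumes "x \<in> paths (2 * k) (k + 1)"
  shows "1 \<le> up_from 1 x" "up_from 1 x < length (touching Up 1 x)"
proof -
  have "rise x = 2" using assms by (simp add: paths_iff)
  then show "1 \<le> up_from 1 x" "up_from 1 x < length (touching Up 1 x)"
    using count_crossings[of 0 0 x] count_crossings[of 1 0 x]
    by (simp_all add: up_from_eq length_touching count_touch)
qed

section \<open>The two bijections and their composition\<close>

definition raised_paths :: "nat \<Rightarrow> nat \<Rightarrow> path set" where
  "raised_paths k e = {x \<in> paths (2 * k) (k + 1). downs_below 1 x = e}"

lemma bij_betw_map_g:
  assumes "e < k"
  shows "bij_betw map_g (dyck_flaws k e) (raised_paths k e)"
proof (rule bij_betw_byWitness[where f' = "\<lambda>x. x[touching Up 1 x ! up_from 1 x := Down]"])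
  note down = flip_down[where r = 0, OF _ _ _ refl refl, unfolded diff_zero add_0_right,
      OF _ le0 down_from_0_less[OF _ assms], folded map_g_def]
  note up = flip_up[where r = 0, OF _ _ _ refl refl, unfolded diff_zero add_0_right,
      OF _ le0 up_from_1_bounds(2)]
  let ?f' = "\<lambda>x. x[touching Up 1 x ! up_from 1 x := Down]"
  show "\<forall>x\<in>dyck_flaws k e. ?f' (map_g x) = x"
    using down(6,7) by (auto simp: dyck_flaws_iff)
  show "\<forall>x\<in>raised_paths k e. map_g (?f' x) = x"
    using up(4,5) by (auto simp: raised_paths_def map_g_def)
  show "map_g ` dyck_flaws k e \<subseteq> raised_paths k e"
    using down(3,8) by (auto simp: raised_paths_def dyck_flaws_iff)
  show "?f' ` raised_paths k e \<subseteq> dyck_flaws k e"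
    using up(3,6) by (auto simp: raised_paths_def dyck_flaws_iff)
qed

lemma bij_betw_map_h: "bij_betw map_h (raised_paths k e) (dyck_flaws k (Suc e))"
proof (rule bij_betw_byWitness[where f' = "\<lambda>x. x[touching Down 0 x ! (down_from 0 x - 1) := Up]"])
  note down = flip_down[where r = 1, OF _ _ _ refl refl, OF _ down_from_0_pos]
  note up = flip_up[where r = 1, OF _ _ _ refl refl, OF _ up_from_1_bounds(1)
      less_imp_diff_less[OF up_from_1_bounds(2)], folded map_h_def]
  let ?f' = "\<lambda>x. x[touching Down 0 x ! (down_from 0 x - 1) := Up]"
  show "\<forall>x\<in>raised_paths k e. ?f' (map_h x) = x"
    using up(4,5) by (auto simp: raised_paths_def)
  show "\<forall>x\<in>dyck_flaws k (Suc e). map_h (?f' x) = x"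
    using down(6,7) by (auto simp: dyck_flaws_iff map_h_def)
  show "map_h ` raised_paths k e \<subseteq> dyck_flaws k (Suc e)"
    using up(3,6) by (force simp: raised_paths_def dyck_flaws_iff)
  show "?f' ` dyck_flaws k (Suc e) \<subseteq> raised_paths k e"
    using down(3,8) by (force simp: raised_paths_def dyck_flaws_iff)
qed

lemma map_f_differs_twice:
  assumes x: "x \<in> dyck_flaws k e" and "e < k"
  shows "card {i. i < 2 * k \<and> x ! i \<noteq> map_f x ! i} = 2"
proof -
  define p where "p = touching Down 0 x ! down_from 0 x"
  define q where "q = touching Up 1 (map_g x) ! (up_from 1 (map_g x) - 1)"
  have xp: "x \<in> paths (2 * k) k"
    using x by (simp add: dyck_flaws_iff)
  note g = flip_down[where r = 0, OF _ _ _ refl refl, unfolded diff_zero add_0_right,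
      OF xp le0 down_from_0_less[OF x \<open>e < k\<close>], folded map_g_def, folded p_def]
  note u = up_from_1_bounds[OF g(3)]
  note h = flip_up[where r = 1, OF _ _ _ refl refl,
      OF g(3) u(1) less_imp_diff_less[OF u(2)], folded q_def]
  have "distinct (touching Up 1 (map_g x))"
    by (simp add: touching_def)
  then have "touching Up 1 (map_g x) ! up_from 1 (map_g x) \<noteq> q"
    using u by (simp add: q_def nth_eq_iff_index_eq)
  then have "p \<noteq> q"
    using g(6) by simp
  have len: "length x = 2 * k"
    using xp by (simp add: paths_iff)
  have g_eq: "map_g x = x[p := Up]" and f_eq: "map_f x = (map_g x)[q := Down]"
    by (simp_all add: map_f_def map_h_def map_g_def p_def q_def)
  \<comment> \<open>The first flip changes only position \<open>p\<close>, so the up-step at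
    \<open>q\<close> is already present in \<open>x\<close>.\<close>
  have "x ! q = Up"
    using h(2) \<open>p \<noteq> q\<close> by (simp add: g_eq)
  then have "{i. i < 2 * k \<and> x ! i \<noteq> map_f x ! i} = {p, q}"
    using g(1,2) h(1) \<open>p \<noteq> q\<close> len by (auto simp: f_eq g_eq nth_list_update)
  then show ?thesis
    using \<open>p \<noteq> q\<close> by simp
qed

theorem theorem2:
  fixes k e :: nat
  assumes "k \<ge> 1" and "e \<in> {0..k - 1}"
  shows "bij_betw map_f (dyck_flaws k e) (dyck_flaws k (e + 1)) \<and>
         (\<forall>x \<in> dyck_flaws k e. card {i. i < 2 * k \<and> x ! i \<noteq> map_f x ! i} = 2)"
proof -
  have "e < k" using assms by auto
  have "map_f = map_h \<circ> map_g"
    by (auto simp: map_f_def)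
  then show ?thesis
    using bij_betw_trans[OF bij_betw_map_g[OF \<open>e < k\<close>] bij_betw_map_h]
      map_f_differs_twice[OF _ \<open>e < k\<close>] by simp
qed

end
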